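(* Let $H$ be an even graph of order $n$. For any positive integer $m\geq 2$, $p(P_m\Box H)=\frac{n_o(P_m\Box H)}{2}$.
   Context: All graphs are finite, simple and undirected. An even graph is a graph in which every vertex has even degree. $P_m$ is the path on $m$ vertices. A path decomposition of a graph $G$ is a collection of edge-disjoint paths covering all edges of $G$; $p(G)$ denotes the minimum number of paths in a path decomposition of $G$. $n_o(G)$ denotes the number of vertices of odd degree in $G$. The Cartesian product $G\Box H$ has vertex set $V(G)\times V(H)$, with $(u_1,v_1)(u_2,v_2)$ an edge iff either $u_1u_2\in E(G)$ and $v_1=v_2$, or $v_1v_2\in E(H)$ and $u_1=u_2$. *)

theory Defs
  imports Complex_Main
begin

datatype 'a graph = Graph (verts: "'a set") (edges: "'a set set")

definition simple_graph :: "'a graph \<Rightarrow> bool" where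
  "simple_graph G \<longleftrightarrow> finite (verts G) \<and> (\<forall>e\<in>edges G. e \<subseteq> verts G \<and> card e = 2)"

definition order :: "'a graph \<Rightarrow> nat" where
  "order G = card (verts G)"

definition degree :: "'a graph \<Rightarrow> 'a \<Rightarrow> nat" where
  "degree G v = card {e \<in> edges G. v \<in> e}"

definition even_graph :: "'a graph \<Rightarrow> bool" where
  "even_graph G \<longleftrightarrow> simple_graph G \<and> (\<forall>v\<in>verts G. even (degree G v))"

definition n_odd :: "'a graph \<Rightarrow> nat" where
  "n_odd G = card {v \<in> verts G. odd (degree G v)}"

definition subgraph :: "'a graph \<Rightarrow> 'a graph \<Rightarrow> bool" where
  "subgraph G' G \<longleftrightarrow> verts G' \<subseteq> verts G \<and> edges G' \<subseteq> edges G"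

definition path_of :: "'a list \<Rightarrow> 'a graph" where
  "path_of xs = Graph (set xs) {{xs ! i, xs ! Suc i} | i. Suc i < length xs}"

definition path_graph :: "nat \<Rightarrow> nat graph" where
  "path_graph m = path_of [0..<m]"

definition is_path :: "'a graph \<Rightarrow> bool" where
  "is_path P \<longleftrightarrow> (\<exists>xs. xs \<noteq> [] \<and> distinct xs \<and> P = path_of xs)"

definition cartesian_product :: "'a graph \<Rightarrow> 'b graph \<Rightarrow> ('a \<times> 'b) graph" where
  "cartesian_product G H = Graph (verts G \<times> verts H)
     {{(u1, v1), (u2, v2)} | u1 v1 u2 v2.
        (u1, v1) \<in> verts G \<times> verts H \<and> (u2, v2) \<in> verts G \<times> verts H \<and>
        ({u1, u2} \<in> edges G \<and> v1 = v2 \<or> {v1, v2} \<in> edges H \<and> u1 = u2)}"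

text \<open>One-vertex paths are admitted as members; having no edges, they never lower the minimum
  number of paths.\<close>

definition path_decomposition :: "'a graph \<Rightarrow> 'a graph set \<Rightarrow> bool" where
  "path_decomposition G D \<longleftrightarrow>
     finite D \<and>
     (\<forall>P\<in>D. is_path P \<and> subgraph P G) \<and>
     (\<forall>P\<in>D. \<forall>Q\<in>D. P \<noteq> Q \<longrightarrow> edges P \<inter> edges Q = {}) \<and>
     (\<Union>P\<in>D. edges P) = edges G"

definition path_number :: "'a graph \<Rightarrow> nat" where
  "path_number G = (LEAST k. \<exists>D. path_decomposition G D \<and> card D = k)"

lemma simple_graph_path_graph: "simple_graph (path_graph m)"
  by (auto simp: simple_graph_def path_graph_def path_of_def)

lemma simple_graph_cartesian_product:
  assumes "simple_graph G" "simple_graph H"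
  shows "simple_graph (cartesian_product G H)"
proof -
  have G: "u1 \<noteq> u2" if "{u1, u2} \<in> edges G" for u1 u2
    using that assms(1) by (force simp: simple_graph_def)
  have H: "v1 \<noteq> v2" if "{v1, v2} \<in> edges H" for v1 v2
    using that assms(2) by (force simp: simple_graph_def)
  show ?thesis
    unfolding simple_graph_def
  proof (intro conjI ballI)
    show "finite (verts (cartesian_product G H))"
      using assms by (simp add: simple_graph_def cartesian_product_def)
  next
    fix e assume "e \<in> edges (cartesian_product G H)"
    then obtain u1 v1 u2 v2 where e: "e = {(u1, v1), (u2, v2)}"
      and V: "(u1, v1) \<in> verts G \<times> verts H" "(u2, v2) \<in> verts G \<times> verts H"
      and A: "{u1, u2} \<in> edges G \<and> v1 = v2 \<or> {v1, v2} \<in> edges H \<and> u1 = u2"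
      unfolding cartesian_product_def graph.sel by blast
    show "e \<subseteq> verts (cartesian_product G H)"
      using e V by (simp add: cartesian_product_def)
    have "(u1, v1) \<noteq> (u2, v2)" using A G H by blast
    then show "card e = 2" unfolding e by (simp only: card_2_iff) blast
  qed
qed

text \<open>Every finite simple graph has a path decomposition (into single edges), so the minimum in
  the definition of the path number is attained.\<close>

lemma path_decomposition_exists:
  assumes "simple_graph G"
  shows "\<exists>D. path_decomposition G D"
proof
  let ?D = "(\<lambda>e. Graph e {e}) ` edges G"
  have "edges G \<subseteq> Pow (verts G)"
    using assms by (auto simp: simple_graph_def)
  moreover have "finite (verts G)"
    using assms by (simp add: simple_graph_def)
  ultimately have "finite (edges G)"
    by (meson finite_Pow_iff finite_subset)
  moreover have "is_path (Graph e {e})" if "e \<in> edges G" for e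
  proof -
    have "card e = 2"
      using assms that by (simp add: simple_graph_def)
    then obtain x y where "e = {x, y}" "x \<noteq> y"
      by (auto simp: card_2_iff)
    then show ?thesis
      unfolding is_path_def path_of_def
      by (intro exI[of _ "[x, y]"]) (auto simp: less_Suc_eq)
  qed
  ultimately show "path_decomposition G ?D"
    using assms by (auto simp: path_decomposition_def subgraph_def simple_graph_def)
qed

end

theory Submission
  imports Defs "HOL-Library.Multiset"
begin

text \<open>Every vertex of the two end layers has odd degree and hence is an end of some path of any
  decomposition, so at least \<open>n\<close> paths are needed. For the converse, an even graph \<open>H\<close> decomposes
  into \<open>n\<close> paths, trivial ones allowed, such that every vertex is an end exactly twice (a form of
  a theorem of Lovasz, proved here by putting edges back one at a time and rerouting as in Fan's
  work on Gallai's conjecture). The multigraph of end pairs is then even, so the paths can be directed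
  such that every vertex is the start of exactly one path and the end of exactly one path. Using
  this system in every layer, one follows the path from its start, climbs the rung at its end, continues
  with the path starting there, and so on up to the last layer; this gives \<open>n\<close> paths that use every
  edge exactly once.\<close>

section \<open>Vertex lists with their edge multisets, and decompositions as multisets of
  lists\<close>

fun path_edges :: "'a list \<Rightarrow> 'a set multiset" where
  "path_edges (x # y # xs) = add_mset {x, y} (path_edges (y # xs))"
| "path_edges _ = {#}"

lemma path_edges_append:
  assumes "xs \<noteq> []" "ys \<noteq> []"
  shows "path_edges (xs @ ys) = add_mset {last xs, hd ys} (path_edges xs + path_edges ys)"
  using assms
proof (induction xs rule: path_edges.induct)
  case ("2_2" v)
  then show ?case by (cases ys) auto
qed auto

lemma path_edges_Cons: "xs \<noteq> [] \<Longrightarrow> path_edges (x # xs) = add_mset {x, hd xs} (path_edges xs)"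
  by (cases xs) auto

lemma path_edges_rev [simp]: "path_edges (rev xs) = path_edges xs"
proof (induction xs rule: path_edges.induct)
  case (1 x y xs)
  then show ?case
    using path_edges_append[of "rev xs @ [y]" "[x]"] by (simp add: insert_commute)
qed auto

lemma path_edges_map: "path_edges (map f xs) = image_mset ((`) f) (path_edges xs)"
  by (induction xs rule: path_edges.induct) auto

lemma path_edges_subset: "e \<in># path_edges xs \<Longrightarrow> e \<subseteq> set xs"
  by (induction xs rule: path_edges.induct) auto

text \<open>Equality of multisets encodes covering and edge-disjointness at once, since
  \<open>mset_set E\<close> has multiplicities at most one. A multiset of lists is used because
  one-vertex paths may be repeated; they carry no edges but do contribute ends.\<close>

definition path_mset :: "'a list multiset \<Rightarrow> 'a set set \<Rightarrow> bool" where
  "path_mset D E \<longleftrightarrow> finite E \<and> (\<forall>p\<in>#D. p \<noteq> [] \<and> distinct p) \<and>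
     (\<Sum>p\<in>#D. path_edges p) = mset_set E"

text \<open>A one-vertex path counts its vertex twice, so the number of ends at a vertex always has
  the parity of its degree.\<close>

definition ends :: "'a list multiset \<Rightarrow> 'a multiset" where
  "ends D = (\<Sum>p\<in>#D. {#hd p, last p#})"

lemma ends_empty [simp]: "ends {#} = {#}"
  and ends_add [simp]: "ends (add_mset p D) = {#hd p, last p#} + ends D"
  by (simp_all add: ends_def)

lemma in_ends: "v \<in># ends D \<longleftrightarrow> (\<exists>p\<in>#D. v = hd p \<or> v = last p)"
  by (induction D) auto

lemma path_mset_mem:
  assumes "path_mset D E" "p \<in># D" "e \<in># path_edges p"
  shows "e \<in> E"
proof -
  have "e \<in># (\<Sum>p\<in>#D. path_edges p)"
    using assms(2,3) by auto
  then have "e \<in># mset_set E"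
    using assms(1) by (simp only: path_mset_def)
  then show ?thesis
    using assms(1) by (simp add: path_mset_def)
qed

text \<open>A shared edge would have multiplicity two in \<open>mset_set E\<close>. Only one
  occurrence of \<open>p\<close> is split off, so \<open>q\<close> may be the same list as
  \<open>p\<close>; hence a path with an edge occurs only once.\<close>

lemma path_mset_unique:
  assumes "path_mset (add_mset p D) E" "e \<in># path_edges p" "q \<in># D"
  shows "e \<notin># path_edges q"
proof
  assume "e \<in># path_edges q"
  obtain D0 where "D = add_mset q D0"
    using assms(3) by (metis multi_member_split)
  then have *: "mset_set E = path_edges p + path_edges q + (\<Sum>p\<in>#D0. path_edges p)"
    using assms(1) by (simp add: path_mset_def union_assoc)
  have "count (path_edges p) e \<ge> 1" "count (path_edges q) e \<ge> 1"
    using \<open>e \<in># path_edges q\<close> assms(2) by (simp_all add: Suc_le_eq)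
  then have "count (mset_set E) e \<ge> 2"
    unfolding * count_union by linarith
  then show False
    by (metis count_mset_set(1,2,3) not_numeral_le_zero numeral_le_one_iff semiring_norm(69))
qed

section \<open>Putting an edge back by rerouting at one of its vertices\<close>

text \<open>A path of \<open>D\<close> through \<open>b\<close> is cut by \<open>b\<close> into two (possibly empty) arms. Reversing a
  nonempty arm exchanges the edge from \<open>b\<close> to the near end of the arm for the edge from \<open>b\<close> to
  its far end; \<open>arm_rel\<close> relates the far end to the near end.\<close>

definition arm_rel :: "'a list multiset \<Rightarrow> 'a \<Rightarrow> ('a \<times> 'a) set" where
  "arm_rel D b = {(last p, hd p) | p q. p \<noteq> [] \<and> (rev p @ b # q \<in># D \<or> rev q @ b # p \<in># D)}"

lemma arm_edge:
  assumes "p \<noteq> []"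
  shows "{hd p, b} \<in># path_edges (rev p @ b # q)" "{hd p, b} \<in># path_edges (rev q @ b # p)"
proof -
  show 1: "{hd p, b} \<in># path_edges (rev p @ b # q)" for q
    using assms by (simp add: path_edges_append last_rev)
  have "path_edges (rev q @ b # p) = path_edges (rev p @ b # q)"
    using path_edges_rev[of "rev q @ b # p"] by simp
  with 1 show "{hd p, b} \<in># path_edges (rev q @ b # p)" by simp
qed

lemma arm_rel_edge:
  assumes "path_mset D E" "(v, w) \<in> arm_rel D b"
  shows "{w, b} \<in> E"
  using assms by (auto simp: arm_rel_def intro: path_mset_mem arm_edge)

text \<open>The vertex \<open>b\<close> occurs only once in \<open>l\<close>, so the cut is unique
  up to the direction of reading and the two arms are determined as an unordered pair.\<close>

lemma arm_cases:
  assumes "distinct l" "l = rev p @ b # q \<or> l = rev q @ b # p" "l = rev p' @ b # q' \<or> l = rev q' @ b # p'"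
  shows "p' = p \<and> q' = q \<or> p' = q \<and> q' = p"
proof -
  have b: "b \<notin> set p" "b \<notin> set q"
    using assms(1,2) by auto
  have "rev p @ b # q = rev p' @ b # q' \<or> rev p @ b # q = rev q' @ b # p'
    \<or> rev q @ b # p = rev p' @ b # q' \<or> rev q @ b # p = rev q' @ b # p'"
    using assms(2,3) by metis
  then show ?thesis
    using b by (auto simp: append_Cons_eq_iff)
qed

text \<open>The edge from \<open>w\<close> to \<open>b\<close> lies on one path only, and the two
  arms of that path are disjoint, so \<open>w\<close> is the near end of just one arm.\<close>

lemma arm_rel_inj:
  assumes D: "path_mset D E" and vw: "(v, w) \<in> arm_rel D b" "(v', w) \<in> arm_rel D b"
  shows "v = v'"
proof -
  obtain p q l where p: "v = last p" "w = hd p" "p \<noteq> []" "l \<in># D" "l = rev p @ b # q \<or> l = rev q @ b # p"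
    using vw(1) by (auto simp: arm_rel_def)
  obtain p' q' l' where p': "v' = last p'" "w = hd p'" "p' \<noteq> []" "l' \<in># D" "l' = rev p' @ b # q' \<or> l' = rev q' @ b # p'"
    using vw(2) by (auto simp: arm_rel_def)
  have e: "{w, b} \<in># path_edges l" "{w, b} \<in># path_edges l'"
    using p p' arm_edge[of p b q] arm_edge[of p' b q'] by auto
  obtain D0 where D0: "D = add_mset l D0"
    using p(4) by (metis multi_member_split)
  have "l' = l"
    using path_mset_unique[OF D[unfolded D0] e(1)] e(2) p'(4) D0 by auto
  have l: "distinct l"
    using D p(4) by (auto simp: path_mset_def)
  then have "p' = p \<and> q' = q \<or> p' = q \<and> q' = p"
    using arm_cases p(5) p'(5) \<open>l' = l\<close> by metis
  moreover have False if "p' = q" "p \<noteq> p'"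
  proof -
    have "set p \<inter> set q = {}" using l p(5) by auto
    moreover have "w \<in> set p" "w \<in> set q" using p(2,3) p'(2,3) that(1) by (metis hd_in_set)+
    ultimately show False by blast
  qed
  ultimately show ?thesis
    using p(1) p'(1) by auto
qed

text \<open>The path ending at \<open>a\<close> is prolonged to \<open>b\<close>, so one end moves
  from \<open>a\<close> to \<open>b\<close>. Stating this with an element added on both sides avoids
  multiset subtraction.\<close>

lemma extend_path:
  assumes "path_mset D E" "{a, b} \<notin> E" "l \<in># D" "b \<notin> set l" "a = hd l \<or> a = last l"
  shows "\<exists>D'. path_mset D' (insert {a, b} E) \<and> add_mset a (ends D') = add_mset b (ends D)"
proof -
  obtain D0 where D: "D = add_mset l D0"
    using assms(3) by (metis multi_member_split)
  define k where "k = (if a = hd l then l else rev l)"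
  have l: "l \<noteq> []" "distinct l"
    using assms(1,3) by (auto simp: path_mset_def)
  then have k: "k \<noteq> []" "distinct k" "b \<notin> set k" "hd k = a" "path_edges k = path_edges l" "{#hd k, last k#} = {#hd l, last l#}"
    using assms(4,5) by (auto simp: k_def hd_rev last_rev)
  have "path_mset (add_mset (b # k) D0) (insert {a, b} E)"
    using assms(1,2) k by (auto simp: path_mset_def D path_edges_Cons insert_commute)
  moreover have "add_mset a (ends (add_mset (b # k) D0)) = add_mset b (ends D)"
    using k by (simp add: D)
  ultimately show ?thesis by blast
qed

text \<open>Replacing \<open>rev p @ b # q\<close> by \<open>p @ b # q\<close> keeps the edges
  inside the arm; the edge at \<open>b\<close> and the end of the path trade places. The last two
  conclusions let the operation be iterated: all other arm pairs survive, and paths avoiding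
  \<open>b\<close> are untouched.\<close>

lemma reverse_arm:
  assumes D: "path_mset D E" and "{a, b} \<notin> E" "a \<noteq> b" and ax: "(a, x) \<in> arm_rel D b"
  obtains D' where "path_mset D' (insert {a, b} (E - {{x, b}}))" "add_mset a (ends D') = add_mset x (ends D)"
    "arm_rel D b - {(a, x)} \<subseteq> arm_rel D' b" "\<And>l. l \<in># D \<Longrightarrow> b \<notin> set l \<Longrightarrow> l \<in># D'"
proof -
  obtain p q l where p: "a = last p" "x = hd p" "p \<noteq> []" "l \<in># D" "l = rev p @ b # q \<or> l = rev q @ b # p"
    using ax by (auto simp: arm_rel_def)
  obtain D0 where D0: "D = add_mset l D0"
    using p(4) by (metis multi_member_split)
  have xb: "{x, b} \<in> E"
    using arm_rel_edge[OF D ax] .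
  have "distinct l" using D p(4) by (auto simp: path_mset_def)
  then have "distinct (rev p @ b # q)" using p(5) by auto
  moreover have "path_edges l = path_edges (rev p @ b # q)"
    using p(5) path_edges_rev[of "rev q @ b # p"] by (elim disjE) simp_all
  moreover have "{#hd l, last l#} = {#a, last (b # q)#}"
    using p(1,3,5) by (elim disjE) (simp_all add: hd_append hd_rev add_mset_commute)
  ultimately have ll: "path_edges l = path_edges (rev p @ b # q)" "distinct (rev p @ b # q)"
    "{#hd l, last l#} = {#a, last (b # q)#}" by simp_all
  let ?k = "p @ b # q"
  have eq: "add_mset {x, b} (path_edges ?k) = add_mset {a, b} (path_edges l)"
    using p(1-3) by (simp add: ll path_edges_append last_rev)
  have "path_mset (add_mset ?k D0) (insert {a, b} (E - {{x, b}}))"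
    unfolding path_mset_def
  proof (intro conjI)
    show "finite (insert {a, b} (E - {{x, b}}))"
      using D by (simp add: path_mset_def)
    show "\<forall>p\<in>#add_mset ?k D0. p \<noteq> [] \<and> distinct p"
      using D ll(2) by (auto simp: D0 path_mset_def)
    have "add_mset {x, b} (path_edges ?k + (\<Sum>p\<in>#D0. path_edges p)) = add_mset {a, b} (mset_set E)"
      using D eq by (metis D0 path_mset_def image_mset_add_mset sum_mset.insert union_mset_add_mset_left)
    also have "\<dots> = add_mset {x, b} (mset_set (insert {a, b} (E - {{x, b}})))"
      using D xb assms(2) by (auto simp: path_mset_def mset_set.remove add_mset_commute)
    finally show "(\<Sum>p\<in>#add_mset ?k D0. path_edges p) = mset_set (insert {a, b} (E - {{x, b}}))"
      by simp
  qed
  moreover have "add_mset a (ends (add_mset ?k D0)) = add_mset x (ends D)"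
    using p(1-3) ll(3) by (simp add: D0 add_mset_commute)
  moreover have "arm_rel D b - {(a, x)} \<subseteq> arm_rel (add_mset ?k D0) b"
  proof
    fix z assume z: "z \<in> arm_rel D b - {(a, x)}"
    then obtain p' q' l' where p': "z = (last p', hd p')" "p' \<noteq> []" "l' \<in># D" "l' = rev p' @ b # q' \<or> l' = rev q' @ b # p'"
      by (auto simp: arm_rel_def)
    show "z \<in> arm_rel (add_mset ?k D0) b"
    proof (cases "l' = l")
      case True
      have "distinct l" using D p(4) by (auto simp: path_mset_def)
      then have "p' = p \<and> q' = q \<or> p' = q \<and> q' = p"
        using arm_cases p(5) p'(4) True by metis
      \<comment> \<open>The arm \<open>p\<close> accounts only for the excluded pair
        \<open>(a, x)\<close>, so a remaining pair on this path comes from the other arm, which the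
        reversal leaves in place.\<close>
      then have "p' = q" using z p p' by auto
      moreover have "rev (rev p) @ b # p' \<in># add_mset ?k D0" using \<open>p' = q\<close> by simp
      ultimately show ?thesis using p'(1,2) unfolding arm_rel_def by blast
    next
      case False
      then have "l' \<in># D0" using p'(3) D0 by simp
      then show ?thesis using p' unfolding arm_rel_def by auto
    qed
  qed
  moreover have "l' \<in># add_mset ?k D0" if "l' \<in># D" "b \<notin> set l'" for l'
    using that p(5) D0 by auto
  ultimately show thesis using that by blast
qed

text \<open>Reversing the first arm inserts \<open>{a, b}\<close> and makes \<open>{x, b}\<close>
  the missing edge, with a chain from \<open>x\<close> that is one step shorter. The ends move from
  \<open>a\<close> to \<open>x\<close> and then from \<open>x\<close> to \<open>b\<close>. At the
  end of the chain a path avoiding \<open>b\<close> can simply be extended.\<close>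

lemma add_edge_chain:
  assumes "path_mset D E" "{a, b} \<notin> E" "a \<noteq> b" "(a, z) \<in> arm_rel D b ^^ n"
    "l \<in># D" "b \<notin> set l" "z = hd l \<or> z = last l"
  shows "\<exists>D'. path_mset D' (insert {a, b} E) \<and> add_mset a (ends D') = add_mset b (ends D)"
  using assms
proof (induction n arbitrary: D E a)
  case 0
  then show ?case using extend_path by fastforce
next
  case (Suc n)
  let ?T = "arm_rel D b"
  obtain x where ax: "(a, x) \<in> ?T" and xz: "(x, z) \<in> ?T ^^ n"
    using Suc.prems(4) by (meson relpow_Suc_D2)
  obtain D1 where D1: "path_mset D1 (insert {a, b} (E - {{x, b}}))" "add_mset a (ends D1) = add_mset x (ends D)"
    "?T - {(a, x)} \<subseteq> arm_rel D1 b" "\<And>l. l \<in># D \<Longrightarrow> b \<notin> set l \<Longrightarrow> l \<in># D1"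
    using reverse_arm[OF Suc.prems(1-3) ax] by metis
  have xb: "{x, b} \<in> E"
    using arm_rel_edge[OF Suc.prems(1) ax] .
  then have "x \<noteq> a" using Suc.prems(2) by auto
  \<comment> \<open>Since \<open>{a, b}\<close> is not in \<open>E\<close>, no arm has near end
    \<open>a\<close>. The rest of the chain therefore never returns to \<open>a\<close> and does not
    use the one pair that the reversal may destroy.\<close>
  have notin: "y \<noteq> a" if "(u, y) \<in> ?T" for u y
    using arm_rel_edge[OF Suc.prems(1) that] Suc.prems(2) by auto
  have "(x, y) \<in> arm_rel D1 b ^^ k \<and> y \<noteq> a" if "(x, y) \<in> ?T ^^ k" for y k
    using that
  proof (induction k arbitrary: y)
    case 0
    then show ?case using \<open>x \<noteq> a\<close> by simp
  next
    case (Suc k)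
    then obtain u where u: "(x, u) \<in> ?T ^^ k" "(u, y) \<in> ?T" by auto
    then have "(u, y) \<in> arm_rel D1 b" using D1(3) Suc.IH by blast
    then show ?case using u notin Suc.IH by auto
  qed
  then have "(x, z) \<in> arm_rel D1 b ^^ n" using xz by blast
  moreover have "x \<noteq> b"
    using ax Suc.prems(1) by (fastforce simp: arm_rel_def path_mset_def dest: hd_in_set)
  moreover have "{x, b} \<notin> insert {a, b} (E - {{x, b}})"
    using \<open>x \<noteq> a\<close> by (auto simp: doubleton_eq_iff)
  ultimately obtain D2 where D2: "path_mset D2 (insert {x, b} (insert {a, b} (E - {{x, b}})))"
    "add_mset x (ends D2) = add_mset b (ends D1)"
    using Suc.IH[OF D1(1)] D1(4) Suc.prems(5-7) by blast
  have "insert {x, b} (insert {a, b} (E - {{x, b}})) = insert {a, b} E"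
    using xb by auto
  moreover have "add_mset a (ends D2) = add_mset b (ends D)"
  proof -
    have "add_mset x (add_mset a (ends D2)) = add_mset b (add_mset a (ends D1))"
      using D2(2) by (metis add_mset_commute)
    also have "\<dots> = add_mset x (add_mset b (ends D))"
      using D1(2) by (metis add_mset_commute)
    finally show ?thesis by simp
  qed
  ultimately show ?case using D2(1) by metis
qed

text \<open>By \<open>nb\<close> all vertices reachable from \<open>a\<close> along
  \<open>arm_rel\<close> are ends of paths. If all paths ending at them passed through
  \<open>b\<close>, each would have a successor, never equal to \<open>a\<close>; by injectivity a
  finite set containing \<open>a\<close> would inject into itself without \<open>a\<close>. So some
  chain reaches an end of a path avoiding \<open>b\<close>.\<close>

lemma add_edge:
  assumes D: "path_mset D E" and ab: "{a, b} \<notin> E" "a \<noteq> b"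
    and a: "a \<in># ends D" and nb: "\<And>w. {w, b} \<in> E \<Longrightarrow> w \<in># ends D"
  shows "\<exists>D'. path_mset D' (insert {a, b} E) \<and> add_mset a (ends D') = add_mset b (ends D)"
proof -
  let ?T = "arm_rel D b"
  define R where "R = ?T\<^sup>* `` {a}"
  have R: "v \<in># ends D \<and> v \<noteq> b" if "v \<in> R" for v
  proof -
    have "(a, v) \<in> ?T\<^sup>*" using that by (simp add: R_def)
    then show ?thesis
    proof (cases rule: rtranclE)
      case base
      then show ?thesis using a ab by simp
    next
      case (step u)
      then have "v \<noteq> b"
        using D by (fastforce simp: arm_rel_def path_mset_def dest: hd_in_set)
      then show ?thesis using arm_rel_edge[OF D step(2)] nb by simp
    qed
  qed
  have fin: "finite R"
    using R by (metis finite_set_mset rev_finite_subset subsetI)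
  have "\<exists>z\<in>R. \<exists>l\<in>#D. b \<notin> set l \<and> (z = hd l \<or> z = last l)"
  proof (rule ccontr)
    assume neg: "\<not> ?thesis"
    have "\<exists>w. (v, w) \<in> ?T" if v: "v \<in> R" for v
    proof -
      obtain l where l: "l \<in># D" "v = hd l \<or> v = last l"
        using R[OF v] by (auto simp: in_ends)
      then have "b \<in> set l" using neg v by blast
      then obtain p q where pq: "l = p @ b # q" by (meson split_list)
      from l(2) show ?thesis
      proof
        assume "v = hd l"
        then have "p \<noteq> []" using R[OF v] pq by auto
        then have "(last (rev p), hd (rev p)) \<in> ?T"
          using l(1) pq unfolding arm_rel_def by fastforce
        then show ?thesis using \<open>v = hd l\<close> \<open>p \<noteq> []\<close> pq by (auto simp: last_rev)
      next
        assume "v = last l"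
        then have "q \<noteq> []" using R[OF v] pq by (auto split: if_splits)
        moreover have "rev (rev p) @ b # q \<in># D" using l(1) pq by simp
        ultimately have "(last q, hd q) \<in> ?T"
          unfolding arm_rel_def by blast
        then show ?thesis using \<open>v = last l\<close> \<open>q \<noteq> []\<close> pq by auto
      qed
    qed
    then obtain g where g: "\<And>v. v \<in> R \<Longrightarrow> (v, g v) \<in> ?T" by metis
    have "inj_on g R"
      using g arm_rel_inj[OF D] by (metis inj_onI)
    moreover have "g ` R \<subseteq> R - {a}"
      using g arm_rel_edge[OF D g] ab unfolding R_def by (auto intro: rtrancl_into_rtrancl)
    ultimately have "card R \<le> card (R - {a})"
      using fin by (meson card_inj_on_le finite_Diff)
    moreover have "a \<in> R" by (simp add: R_def)
    ultimately show False
      using fin by (metis card_Diff1_less not_le)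
  qed
  then obtain z l where "(a, z) \<in> ?T\<^sup>*" and l: "l \<in># D" "b \<notin> set l" "z = hd l \<or> z = last l"
    by (auto simp: R_def)
  then obtain n where "(a, z) \<in> ?T ^^ n"
    using rtrancl_imp_relpow by blast
  then show ?thesis
    using add_edge_chain[OF D ab] l by blast
qed

section \<open>Path decompositions with prescribed numbers of ends\<close>

definition edge_degree :: "'a set set \<Rightarrow> 'a \<Rightarrow> nat" where
  "edge_degree E v = card {e \<in> E. v \<in> e}"

lemma edge_degree_insert:
  assumes "finite E" "e \<notin> E"
  shows "edge_degree (insert e E) v = edge_degree E v + (if v \<in> e then 1 else 0)"
proof -
  have "{x \<in> insert e E. v \<in> x} = (if v \<in> e then insert e {x \<in> E. v \<in> x} else {x \<in> E. v \<in> x})"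
    by auto
  then show ?thesis
    using assms by (simp add: edge_degree_def)
qed

text \<open>On \<open>U\<close> these are the least positive values with the parity of the
  degree.\<close>

definition end_count :: "'a set \<Rightarrow> 'a set set \<Rightarrow> 'a \<Rightarrow> nat" where
  "end_count U E v = (if v \<notin> U then 0 else if even (edge_degree E v) then 2 else 1)"

text \<open>Allowing one even vertex outside \<open>U\<close>, where no path ends, saves one path when an edge is
  put back; this is what makes the induction on the number of edges work.\<close>

lemma path_mset_ends_exists:
  assumes "finite E" "\<forall>e\<in>E. card e = 2" "finite U"
    and "\<And>v w. v \<in> \<Union>E - U \<Longrightarrow> w \<in> \<Union>E - U \<Longrightarrow> v = w"
    and "\<And>v. v \<in> \<Union>E - U \<Longrightarrow> even (edge_degree E v)"
  shows "\<exists>D. path_mset D E \<and> (\<forall>v. count (ends D) v = end_count U E v)"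
  using assms
proof (induction "card E" arbitrary: E U rule: less_induct)
  case less
  note fin = less.prems(1,3)
  \<comment> \<open>The induction hypothesis for deleting the edge \<open>e\<close>, where
    \<open>x\<close> is the only vertex on the remaining edges that may lie outside the set
    \<open>W\<close>.\<close>
  have IH: "\<exists>D. path_mset D (E - {e}) \<and> (\<forall>v. count (ends D) v = end_count W (E - {e}) v)"
    if "e \<in> E" "finite W" "\<Union>(E - {e}) \<subseteq> insert x W" "x \<in> W \<or> even (edge_degree (E - {e}) x)" for e W x
  proof (rule less.hyps)
    show "card (E - {e}) < card E" using fin(1) that(1) by (rule card_Diff1_less)
    have "v = x" if "v \<in> \<Union>(E - {e}) - W" for v
      using that \<open>\<Union>(E - {e}) \<subseteq> insert x W\<close> by blast
    then show "v = w" if "v \<in> \<Union>(E - {e}) - W" "w \<in> \<Union>(E - {e}) - W" for v w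
      using that by metis
    show "even (edge_degree (E - {e}) v)" if "v \<in> \<Union>(E - {e}) - W" for v
      using that \<open>\<Union>(E - {e}) \<subseteq> insert x W\<close> \<open>x \<in> W \<or> even (edge_degree (E - {e}) x)\<close> by blast
  qed (use fin less.prems(2) that(2) in auto)
  have deg: "edge_degree E v = edge_degree (E - {e}) v + (if v \<in> e then 1 else 0)" if "e \<in> E" for e v
    using edge_degree_insert[of "E - {e}" e v] that fin(1) by (simp add: insert_absorb)
  \<comment> \<open>Putting \<open>e\<close> back by \<open>add_edge\<close> moves one end from
    \<open>a\<close> to \<open>x\<close>. The last premise states the resulting change of the
    prescribed counts without subtraction.\<close>
  have add: "\<exists>D'. path_mset D' E \<and> (\<forall>v. count (ends D') v = end_count W' E v)"
    if "path_mset D (E - {e})" "\<And>v. count (ends D) v = end_count W (E - {e}) v"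
      "e \<in> E" "e = {a, x}" "a \<noteq> x" "a \<in> W" "\<Union>(E - {e}) \<subseteq> insert x W"
      "\<And>v. end_count W' E v + (if v = a then 1 else 0) = end_count W (E - {e}) v + (if v = x then 1 else 0)"
    for D e W W' a x
  proof -
    note * = that
    have W: "v \<in># ends D" if "v \<in> W" for v
    proof -
      have "0 < count (ends D) v"
        using that \<open>\<And>v. count (ends D) v = end_count W (E - {e}) v\<close> by (simp add: end_count_def)
      then show ?thesis by simp
    qed
    have nb: "w \<in># ends D" if "{w, x} \<in> E - {e}" for w
    proof -
      have "w \<noteq> x" using that less.prems(2) by fastforce
      then show ?thesis using that \<open>\<Union>(E - {e}) \<subseteq> insert x W\<close> W by blast
    qed
    obtain D' where D': "path_mset D' (insert {a, x} (E - {e}))" "add_mset a (ends D') = add_mset x (ends D)"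
      using add_edge[OF *(1), of a x] W nb *(4-6) by blast
    have "count (ends D') v = end_count W' E v" for v
    proof -
      have "count (add_mset a (ends D')) v = count (add_mset x (ends D)) v" using D'(2) by simp
      then have "count (ends D') v + (if v = a then 1 else 0) = end_count W (E - {e}) v + (if v = x then 1 else 0)"
        using *(2) by (auto split: if_splits)
      then show ?thesis using *(8)[of v] by linarith
    qed
    moreover have "insert {a, x} (E - {e}) = E" using *(3,4) by blast
    ultimately show ?thesis using D'(1) by metis
  qed
  \<comment> \<open>The case of an even vertex \<open>b\<close> where no path may end. An edge from
    \<open>b\<close> to \<open>x\<close> is deleted, which makes \<open>b\<close> odd, so
    \<open>b\<close> receives one end; putting the edge back moves this end to
    \<open>x\<close>.\<close>
  have B: "\<exists>D. path_mset D E \<and> (\<forall>v. count (ends D) v = end_count W E v)"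
    if W: "finite W" "b \<in> \<Union>E" "b \<notin> W" "even (edge_degree E b)" "\<Union>E \<subseteq> insert b W" for W b
  proof -
    obtain e where e: "e \<in> E" "b \<in> e" using W(2) by blast
    then obtain x where x: "e = {b, x}" "b \<noteq> x"
      using less.prems(2) by (metis card_2_iff doubleton_eq_iff insertE singletonD)
    have xW: "x \<in> W" using W(5) e(1) x by blast
    show ?thesis
    proof (cases "even (edge_degree E x)")
      case True
      \<comment> \<open>Here \<open>x\<close> is odd after the deletion and has one end; the end
        coming from \<open>b\<close> makes two.\<close>
      obtain D where D: "path_mset D (E - {e})" "\<And>v. count (ends D) v = end_count (insert b W) (E - {e}) v"
        using IH[OF e(1), of "insert b W" b] W(1,5) by blast
      show ?thesis
        by (rule add[OF D e(1) x]) (use W x xW True deg[OF e(1)] in \<open>auto simp: end_count_def\<close>)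
    next
      case False
      \<comment> \<open>Here \<open>x\<close> is even after the deletion, so it takes over the role
        of the exceptional vertex; the end coming from \<open>b\<close> is its only one.\<close>
      let ?W = "insert b (W - {x})"
      have sub: "\<Union>(E - {e}) \<subseteq> insert x ?W" using W(5) by blast
      have "even (edge_degree (E - {e}) x)" using False deg[OF e(1), of x] x by simp
      then obtain D where D: "path_mset D (E - {e})" "\<And>v. count (ends D) v = end_count ?W (E - {e}) v"
        using IH[OF e(1) _ sub] W(1) by blast
      show ?thesis
        by (rule add[OF D e(1) x _ sub]) (use W x xW False deg[OF e(1)] in \<open>auto simp: end_count_def\<close>)
    qed
  qed
  show ?case
  proof (cases "\<Union>E \<subseteq> U")
    case False
    then obtain b where "b \<in> \<Union>E" "b \<notin> U" by blast
    then show ?thesis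
      using B[OF fin(2), of b] less.prems(4,5) by (metis DiffI insertCI subsetI)
  next
    case sub: True
    show ?thesis
    proof (cases "E = {}")
      case True
      \<comment> \<open>One trivial path at each vertex gives the two ends required at degree
        zero.\<close>
      let ?D = "image_mset (\<lambda>v. [v]) (mset_set U)"
      have "count (ends ?D) v = end_count U E v" for v
        using fin(2) True unfolding end_count_def
        by (induction U rule: finite_induct) (auto simp: edge_degree_def)
      moreover have "path_mset ?D E"
        using True by (simp add: path_mset_def image_mset.compositionality comp_def)
      ultimately show ?thesis by blast
    next
      case False
      then obtain e where e: "e \<in> E" by blast
      then obtain a x where ax: "e = {a, x}" "a \<noteq> x"
        using less.prems(2) by (meson card_2_iff)
      show ?thesis
      proof (cases "\<exists>b\<in>\<Union>E. even (edge_degree E b)")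
        case True
        then obtain b where b: "b \<in> \<Union>E" "even (edge_degree E b)" by blast
        then obtain D where D: "path_mset D E" "\<And>v. count (ends D) v = end_count (U - {b}) E v"
          using B[of "U - {b}" b] fin(2) sub by blast
        \<comment> \<open>With \<open>b\<close> exempted, no path of \<open>D\<close> ends there;
          the trivial path supplies both ends.\<close>
        have "path_mset (add_mset [b] D) E"
          using D(1) by (simp add: path_mset_def)
        moreover have "count (ends (add_mset [b] D)) v = end_count U E v" for v
          using D(2) b sub by (auto simp: end_count_def)
        ultimately show ?thesis by blast
      next
        case False
        then have odd: "odd (edge_degree E a)" "odd (edge_degree E x)"
          using e ax by blast+
        \<comment> \<open>All vertices on edges are odd, so deleting \<open>e\<close> makes both its
          vertices even. With \<open>x\<close> exempted, \<open>a\<close> has two ends and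
          \<open>x\<close> none, and putting \<open>e\<close> back leaves one at each.\<close>
        have sub': "\<Union>(E - {e}) \<subseteq> insert x (U - {x})" using sub by blast
        have "even (edge_degree (E - {e}) x)" using odd deg[OF e, of x] ax by simp
        then obtain D where D: "path_mset D (E - {e})" "\<And>v. count (ends D) v = end_count (U - {x}) (E - {e}) v"
          using IH[OF e _ sub'] fin(2) by blast
        show ?thesis
          by (rule add[OF D e ax _ sub']) (use sub e ax odd deg[OF e] in \<open>auto simp: end_count_def\<close>)
      qed
    qed
  qed
qed

section \<open>Directing the paths\<close>

abbreviation reorientation :: "'a list multiset \<Rightarrow> 'a list multiset \<Rightarrow> bool" where
  "reorientation \<equiv> rel_mset (\<lambda>p q. q = p \<or> q = rev p)"

lemma reorientation_image_mset:
  assumes "reorientation D D'" "\<And>p. f (rev p) = f p"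
  shows "image_mset f D' = image_mset f D"
proof -
  have "rel_mset R D D' \<Longrightarrow> (\<And>p q. R p q \<Longrightarrow> f q = f p) \<Longrightarrow> image_mset f D' = image_mset f D" for R
    by (induction rule: rel_mset_induct) auto
  then show ?thesis
    using assms by blast
qed

text \<open>Two lists that meet at an end are merged and the result is oriented by induction.\<close>

lemma balanced_orientation:
  assumes "\<And>v. even (count (ends D) v)"
  shows "\<exists>D'. reorientation D D' \<and> image_mset hd D' = image_mset last D'"
  using assms
proof (induction "size D" arbitrary: D rule: less_induct)
  case less
  show ?case
  proof (cases D)
    case empty
    then show ?thesis by (intro exI[of _ "{#}"]) (simp add: rel_mset_Zero)
  next
    case (add p D0)
    show ?thesis
    proof (cases "hd p = last p")
      case True
      have "even (count (ends D0) v)" for v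
        using less.prems[of v] add True by (auto split: if_splits)
      then obtain D' where "reorientation D0 D'" "image_mset hd D' = image_mset last D'"
        using less.hyps[of D0] add by auto
      then show ?thesis
        using add True by (intro exI[of _ "add_mset p D'"]) (auto intro: rel_mset_Plus)
    next
      case False
      have "odd (count (ends D0) (last p))"
        using less.prems[of "last p"] add False by (auto split: if_splits)
      then have "last p \<in># ends D0" by (metis count_inI even_zero)
      then obtain q where q: "q \<in># D0" "last p = hd q \<or> last p = last q"
        by (auto simp: in_ends)
      then obtain D1 where D1: "D0 = add_mset q D1"
        by (metis multi_member_split)
      define q' where "q' = (if last p = hd q then q else rev q)"
      have q': "hd q' = last p" "{#hd q', last q'#} = {#hd q, last q#}" "q' = q \<or> q' = rev q"
        using q(2) by (auto simp: q'_def hd_rev last_rev)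
      \<comment> \<open>Only ends matter for the balance, so the merged list is represented by its
        two outer ends. It need not be a path, and the ends may even coincide.\<close>
      let ?r = "[hd p, last q']"
      have "ends D = {#last p, last p#} + ends (add_mset ?r D1)"
        using q'(1,2) by (simp add: add D1 add_mset_commute)
      then have even: "even (count (ends (add_mset ?r D1)) v)" for v
        using less.prems[of v] by (auto split: if_splits)
      have "size (add_mset ?r D1) < size D" by (simp add: add D1)
      then obtain D2 where D2: "reorientation (add_mset ?r D1) D2" "image_mset hd D2 = image_mset last D2"
        using less.hyps even by blast
      then obtain r D3 where D3: "D2 = add_mset r D3" "r = ?r \<or> r = rev ?r" "reorientation D1 D3"
        using msed_rel_invL[OF D2(1)] by (elim exE conjE)
      \<comment> \<open>The direction chosen for \<open>?r\<close> is applied to both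
        \<open>p\<close> and \<open>q'\<close>. Their common vertex is then once a start and once an
        end, which does not affect the balance.\<close>
      show ?thesis
      proof (cases "r = ?r")
        case True
        have "reorientation D (add_mset p (add_mset q' D3))"
          unfolding add D1 using q'(3) D3(3) by (intro rel_mset_Plus) auto
        then show ?thesis
          using D2(2) D3(1) True q'(1) by (intro exI[of _ "add_mset p (add_mset q' D3)"]) (auto simp: add_mset_commute)
      next
        case False
        have "reorientation D (add_mset (rev p) (add_mset (rev q') D3))"
          unfolding add D1 using q'(3) D3(3) by (intro rel_mset_Plus) auto
        then show ?thesis
          using D2(2) D3(1,2) False q'(1)
          by (intro exI[of _ "add_mset (rev p) (add_mset (rev q') D3)"]) (auto simp: hd_rev last_rev add_mset_commute)
      qed
    qed
  qed
qed

section \<open>Path systems indexed by the start vertex\<close>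

text \<open>Used with \<open>f = hd\<close>, to turn a multiset of directed paths with each vertex
  as start exactly once into a function on the vertices.\<close>

lemma image_mset_eq_mset_set:
  assumes "finite V" "image_mset f D = mset_set V"
  shows "\<exists>P. D = image_mset P (mset_set V) \<and> (\<forall>v\<in>V. f (P v) = v)"
  using assms
proof (induction V arbitrary: D rule: finite_induct)
  case empty
  then show ?case by simp
next
  case (insert v V)
  then have "image_mset f D = add_mset v (mset_set V)" by simp
  then obtain D1 p where D: "D = add_mset p D1" "f p = v" "image_mset f D1 = mset_set V"
    by (meson msed_map_invR)
  then obtain P where P: "D1 = image_mset P (mset_set V)" "\<forall>v\<in>V. f (P v) = v"
    using insert.IH by blast
  have "image_mset (P(v := p)) (mset_set V) = image_mset P (mset_set V)"
    using insert.hyps by (intro image_mset_cong) auto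
  moreover have "image_mset (P(v := p)) (mset_set (insert v V)) = add_mset p (image_mset (P(v := p)) (mset_set V))"
    using insert.hyps by simp
  ultimately have "D = image_mset (P(v := p)) (mset_set (insert v V))"
    using D(1) P(1) by metis
  moreover have "\<forall>w\<in>insert v V. f ((P(v := p)) w) = w"
    using D(2) P(2) by simp
  ultimately show ?case by blast
qed

lemma set_path_edges: "p \<noteq> [] \<Longrightarrow> set p = insert (hd p) (\<Union>(set_mset (path_edges p)))"
  by (induction p rule: path_edges.induct) auto

text \<open>Indexing by starts makes every vertex a start exactly once; the bijection makes it an
  end exactly once. The permutation sending \<open>v\<close> to \<open>last (P v)\<close> tells
  which path continues in the next layer.\<close>

definition path_system :: "'a set \<Rightarrow> 'a set set \<Rightarrow> ('a \<Rightarrow> 'a list) \<Rightarrow> bool" where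
  "path_system V E P \<longleftrightarrow> (\<forall>v\<in>V. P v \<noteq> [] \<and> distinct (P v) \<and> set (P v) \<subseteq> V \<and> hd (P v) = v) \<and>
     bij_betw (\<lambda>v. last (P v)) V V \<and> (\<Sum>v\<in>V. path_edges (P v)) = mset_set E"

text \<open>As all degrees are even, taking \<open>U = V\<close> gives exactly two ends at each
  vertex. A balanced orientation splits these into one start and one end.\<close>

lemma path_system_exists:
  assumes V: "finite V" "\<forall>e\<in>E. e \<subseteq> V \<and> card e = 2" "\<forall>v\<in>V. even (edge_degree E v)"
  shows "\<exists>P. path_system V E P"
proof -
  have "finite E"
    using V by (meson Pow_iff finite_Pow_iff finite_subset subsetI)
  moreover have "\<Union>E - V = {}" using V(2) by blast
  ultimately obtain D where D: "path_mset D E" "\<And>v. count (ends D) v = end_count V E v"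
    using path_mset_ends_exists[of E V] V by (metis empty_iff)
  then have cnt: "count (ends D) v = 2 * count (mset_set V) v" for v
    using V(1,3) by (simp add: end_count_def)
  obtain D' where D': "reorientation D D'" "image_mset hd D' = image_mset last D'"
    using balanced_orientation[of D] cnt by auto
  \<comment> \<open>Being a path is invariant under reversal, so it is transferred as a truth-valued
    image.\<close>
  have "image_mset (\<lambda>p. p \<noteq> [] \<and> distinct p) D' = image_mset (\<lambda>p. p \<noteq> [] \<and> distinct p) D"
    by (rule reorientation_image_mset[OF D'(1)]) simp
  moreover have "False \<notin># image_mset (\<lambda>p. p \<noteq> [] \<and> distinct p) D"
    using D(1) by (auto simp: path_mset_def)
  ultimately have paths: "p \<noteq> [] \<and> distinct p" if "p \<in># D'" for p
    using that by (metis (mono_tags, lifting) image_eqI set_image_mset)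
  have edges: "(\<Sum>p\<in>#D'. path_edges p) = mset_set E"
    using reorientation_image_mset[OF D'(1), of path_edges] D(1) by (simp add: path_mset_def)
  have "ends D' = ends D"
    unfolding ends_def
    by (subst reorientation_image_mset[OF D'(1)]) (simp_all add: hd_rev last_rev add_mset_commute)
  moreover have "ends M = image_mset hd M + image_mset last M" for M :: "'a list multiset"
    by (induction M) auto
  ultimately have "count (ends D) v = 2 * count (image_mset hd D') v" for v
    using D'(2) by (metis count_union mult_2)
  then have hd: "image_mset hd D' = mset_set V"
    using cnt by (intro multiset_eqI) (metis mult_cancel1 zero_neq_numeral)
  then obtain P where P: "D' = image_mset P (mset_set V)" "\<forall>v\<in>V. hd (P v) = v"
    using image_mset_eq_mset_set[OF V(1)] by blast
  have last: "image_mset (\<lambda>v. last (P v)) (mset_set V) = mset_set V"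
    using D'(2) hd by (simp add: P(1) image_mset.compositionality comp_def)
  have "(\<lambda>v. last (P v)) ` V = V"
    using arg_cong[OF last, of set_mset] V(1) by simp
  then have "bij_betw (\<lambda>v. last (P v)) V V"
    using V(1) by (simp add: bij_betw_def eq_card_imp_inj_on)
  moreover have sum: "(\<Sum>v\<in>V. path_edges (P v)) = mset_set E"
    using edges by (simp add: P(1) sum_unfold_sum_mset image_mset.compositionality comp_def)
  moreover have "P v \<noteq> [] \<and> distinct (P v) \<and> set (P v) \<subseteq> V \<and> hd (P v) = v" if "v \<in> V" for v
  proof -
    have Pv: "P v \<in># D'" using that V(1) P(1) by simp
    have "path_mset D' E" using edges paths \<open>finite E\<close> by (simp add: path_mset_def)
    then have "\<Union>(set_mset (path_edges (P v))) \<subseteq> V"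
      using path_mset_mem[OF _ Pv] V(2) by blast
    then show ?thesis
      using paths[OF Pv] set_path_edges[of "P v"] P(2) that by simp
  qed
  ultimately show ?thesis unfolding path_system_def by blast
qed

section \<open>From lists to path graphs; bounds for the path number\<close>

lemma edges_path_of: "edges (path_of xs) = set_mset (path_edges xs)"
proof (induction xs rule: path_edges.induct)
  case (1 x y xs)
  have "{{(x # y # xs) ! i, (x # y # xs) ! Suc i} | i. Suc i < length (x # y # xs)}
      = insert {x, y} {{(y # xs) ! i, (y # xs) ! Suc i} | i. Suc i < length (y # xs)}" (is "?L = ?R")
  proof
    show "?L \<subseteq> ?R"
    proof
      fix e assume "e \<in> ?L"
      then obtain i where "e = {(x # y # xs) ! i, (x # y # xs) ! Suc i}" "Suc i < length (x # y # xs)" by blast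
      then show "e \<in> ?R" by (cases i) auto
    qed
    have "e \<in> ?L" if "e = {(y # xs) ! i, (y # xs) ! Suc i}" "Suc i < length (y # xs)" for e i
      using that by (intro CollectI exI[of _ "Suc i"]) auto
    moreover have "{x, y} \<in> ?L"
      by (intro CollectI exI[of _ 0]) auto
    ultimately show "?R \<subseteq> ?L" by blast
  qed
  then show ?case using 1 by (simp add: path_of_def)
qed (auto simp: path_of_def)

lemma verts_path_of [simp]: "verts (path_of xs) = set xs"
  by (simp add: path_of_def)

lemma mset_set_path_edges:
  assumes "distinct xs"
  shows "mset_set (edges (path_of xs)) = path_edges xs"
  using assms unfolding edges_path_of
proof (induction xs rule: path_edges.induct)
  case (1 x y xs)
  have "{x, y} \<notin># path_edges (y # xs)"
    using path_edges_subset[of "{x, y}" "y # xs"] 1(2) by auto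
  then show ?case using 1 by simp
qed auto

text \<open>Passing to the set of path graphs can merge members, such as repeated one-vertex paths,
  but this only lowers their number.\<close>

lemma path_number_le:
  assumes D: "path_mset D (edges G)" and V: "\<And>p. p \<in># D \<Longrightarrow> set p \<subseteq> verts G"
  shows "path_number G \<le> size D"
proof -
  let ?D = "path_of ` set_mset D"
  have sub: "edges (path_of p) \<subseteq> edges G" if "p \<in># D" for p
    using path_mset_mem[OF D that] by (auto simp: edges_path_of)
  have "edges (path_of p) \<inter> edges (path_of q) = {}" if "p \<in># D" "q \<in># D" "path_of p \<noteq> path_of q" for p q
  proof -
    obtain D0 where D0: "D = add_mset p D0" using \<open>p \<in># D\<close> by (metis multi_member_split)
    then have "q \<in># D0" using that by auto
    then show ?thesis
      using path_mset_unique D unfolding D0 edges_path_of by blast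
  qed
  moreover have "edges G \<subseteq> (\<Union>P\<in>?D. edges P)"
  proof
    fix e assume "e \<in> edges G"
    then have "e \<in># (\<Sum>p\<in>#D. path_edges p)" using D by (simp add: path_mset_def)
    then show "e \<in> (\<Union>P\<in>?D. edges P)" by (auto simp: edges_path_of)
  qed
  ultimately have "path_decomposition G ?D"
    unfolding path_decomposition_def
  proof (intro conjI ballI impI)
    fix P assume "P \<in> ?D"
    then obtain p where p: "p \<in># D" "P = path_of p" by blast
    then show "is_path P" using D by (auto simp: is_path_def path_mset_def)
    show "subgraph P G" using p sub V by (auto simp: subgraph_def)
  next
    show "(\<Union>P\<in>?D. edges P) = edges G"
      using sub \<open>edges G \<subseteq> (\<Union>P\<in>?D. edges P)\<close> by blast
  qed blast+
  then have "path_number G \<le> card ?D"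
    unfolding path_number_def by (intro Least_le) blast
  also have "\<dots> \<le> card (set_mset D)" by (rule card_image_le) simp
  also have "\<dots> \<le> size D" by (induction D) (auto simp: card_insert_if)
  finally show ?thesis .
qed

text \<open>Inner vertices have degree two. The exclusive disjunction also covers the one-vertex
  path, whose only vertex has degree zero.\<close>

lemma path_odd_vertex:
  assumes "distinct xs" "xs \<noteq> []"
  shows "odd (degree (path_of xs) v) \<longleftrightarrow> (v = hd xs) \<noteq> (v = last xs)"
proof -
  have "degree (path_of xs) v = size {#e \<in># mset_set (edges (path_of xs)). v \<in> e#}"
    by (simp add: degree_def edges_path_of)
  then have *: "degree (path_of xs) v = size {#e \<in># path_edges xs. v \<in> e#}"
    using assms by (simp add: mset_set_path_edges)
  show ?thesis
    unfolding * using assms by (induction xs rule: path_edges.induct) auto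
qed

text \<open>Degrees add up over the paths, so a vertex of odd degree has odd degree in some path,
  and each path has at most two such vertices.\<close>

lemma n_odd_le:
  assumes "path_decomposition G D"
  shows "n_odd G \<le> 2 * card D"
proof -
  have fin: "finite D" and path: "\<And>P. P \<in> D \<Longrightarrow> is_path P" and un: "(\<Union>P\<in>D. edges P) = edges G"
    and disj: "\<And>P Q. P \<in> D \<Longrightarrow> Q \<in> D \<Longrightarrow> P \<noteq> Q \<Longrightarrow> edges P \<inter> edges Q = {}"
    using assms by (auto simp: path_decomposition_def)
  have P: "card {v. odd (degree P v)} \<le> 2 \<and> finite {v. odd (degree P v)} \<and> finite (edges P)" if P: "P \<in> D" for P
  proof -
    obtain xs where xs: "xs \<noteq> []" "distinct xs" "P = path_of xs"
      using path[OF P] by (auto simp: is_path_def)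
    then have sub: "{v. odd (degree P v)} \<subseteq> {hd xs, last xs}"
      by (auto simp: path_odd_vertex)
    have "card {hd xs, last xs} \<le> 2" by (simp add: card_insert_if)
    then show ?thesis
      using card_mono[OF _ sub] finite_subset[OF sub] xs by (simp add: edges_path_of)
  qed
  have deg: "degree G v = (\<Sum>P\<in>D. degree P v)" for v
  proof -
    have "{e \<in> edges G. v \<in> e} = (\<Union>P\<in>D. {e \<in> edges P. v \<in> e})" using un by blast
    moreover have "card (\<Union>P\<in>D. {e \<in> edges P. v \<in> e}) = (\<Sum>P\<in>D. card {e \<in> edges P. v \<in> e})"
    proof (rule card_UN_disjoint[OF fin])
      show "\<forall>P\<in>D. finite {e \<in> edges P. v \<in> e}" using P by simp
      show "\<forall>P\<in>D. \<forall>Q\<in>D. P \<noteq> Q \<longrightarrow> {e \<in> edges P. v \<in> e} \<inter> {e \<in> edges Q. v \<in> e} = {}"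
        using disj by blast
    qed
    ultimately show ?thesis by (simp add: degree_def)
  qed
  have "{v \<in> verts G. odd (degree G v)} \<subseteq> (\<Union>P\<in>D. {v. odd (degree P v)})"
  proof (rule subsetI, rule ccontr)
    fix v assume "v \<in> {v \<in> verts G. odd (degree G v)}" "v \<notin> (\<Union>P\<in>D. {v. odd (degree P v)})"
    then have "odd (degree G v)" "\<And>P. P \<in> D \<Longrightarrow> even (degree P v)" by blast+
    then have "even (\<Sum>P\<in>D. degree P v)" by (intro dvd_sum) blast
    then show False using \<open>odd (degree G v)\<close> deg by simp
  qed
  then have "n_odd G \<le> card (\<Union>P\<in>D. {v. odd (degree P v)})"
    unfolding n_odd_def using fin P by (intro card_mono) auto
  also have "\<dots> \<le> (\<Sum>P\<in>D. card {v. odd (degree P v)})"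
    by (rule card_UN_le[OF fin])
  also have "\<dots> \<le> (\<Sum>P\<in>D. 2)"
    using P by (intro sum_mono) blast
  finally show ?thesis by simp
qed

section \<open>Paths climbing through the layers\<close>

text \<open>The tower spans the \<open>k\<close> layers from \<open>i\<close> on. Rungs arise from
  the concatenation: in a path system the next piece starts at the vertex where the current one
  ended, one layer higher.\<close>

fun tower :: "('a \<Rightarrow> 'a list) \<Rightarrow> nat \<Rightarrow> nat \<Rightarrow> 'a \<Rightarrow> (nat \<times> 'a) list" where
  "tower P i 0 v = []"
| "tower P i (Suc k) v = map (Pair i) (P v) @ tower P (Suc i) k (last (P v))"

text \<open>The edges of the product between layers \<open>i\<close> and \<open>i + k - 1\<close>;
  the bound \<open>Suc j < i + k\<close> excludes a rung above the top layer.\<close>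

definition tower_edges :: "'a set \<Rightarrow> 'a set set \<Rightarrow> nat \<Rightarrow> nat \<Rightarrow> (nat \<times> 'a) set set" where
  "tower_edges V E i k = {Pair j ` e | j e. i \<le> j \<and> j < i + k \<and> e \<in> E} \<union>
     {{(j, v), (Suc j, v)} | j v. i \<le> j \<and> Suc j < i + k \<and> v \<in> V}"

lemma tower_edges_layer: "i \<le> j \<Longrightarrow> j < i + k \<Longrightarrow> e \<in> E \<Longrightarrow> Pair j ` e \<in> tower_edges V E i k"
  unfolding tower_edges_def by blast

lemma tower_edges_rung:
  "i \<le> j \<Longrightarrow> Suc j < i + k \<Longrightarrow> v \<in> V \<Longrightarrow> {(j, v), (Suc j, v)} \<in> tower_edges V E i k"
  unfolding tower_edges_def by blast

lemma tower_edges_cases: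
  assumes "x \<in> tower_edges V E i k"
  obtains (layer) j e where "x = Pair j ` e" "i \<le> j" "j < i + k" "e \<in> E"
    | (rung) j v where "x = {(j, v), (Suc j, v)}" "i \<le> j" "Suc j < i + k" "v \<in> V"
  using assms unfolding tower_edges_def by blast

lemma tower_edges_0: "tower_edges V E i 0 = {}"
  by (auto simp: tower_edges_def)

lemma tower_edges_Suc:
  "tower_edges V E i (Suc k) = (`) (Pair i) ` E \<union>
     ((if k = 0 then {} else (\<lambda>v. {(i, v), (Suc i, v)}) ` V) \<union> tower_edges V E (Suc i) k)"
proof -
  have 1: "i \<le> j \<and> j < i + Suc k \<and> X \<longleftrightarrow> j = i \<and> X \<or> Suc i \<le> j \<and> j < Suc i + k \<and> X" for j X
    by auto
  have 2: "i \<le> j \<and> Suc j < i + Suc k \<and> X \<longleftrightarrow> j = i \<and> k \<noteq> 0 \<and> X \<or> Suc i \<le> j \<and> Suc j < Suc i + k \<and> X" for j X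
    by auto
  show ?thesis
    unfolding tower_edges_def 1 2 by (cases "k = 0"; simp; blast)
qed

text \<open>Pieces in different layers are disjoint by their first coordinates. The clause on the
  head identifies the edge at a concatenation as a rung.\<close>

lemma tower_path:
  assumes "path_system V E P" "v \<in> V"
  shows "distinct (tower P i k v) \<and> set (tower P i k v) \<subseteq> {i..<i + k} \<times> V \<and>
    (k > 0 \<longrightarrow> tower P i k v \<noteq> [] \<and> hd (tower P i k v) = (i, v))"
  using assms(2)
proof (induction k arbitrary: i v)
  case (Suc k)
  have "P v \<noteq> []" "distinct (P v)" "set (P v) \<subseteq> V" "hd (P v) = v"
    using assms(1) Suc.prems by (auto simp: path_system_def)
  then have "last (P v) \<in> V" by auto
  note IH = Suc.IH[OF this, of "Suc i"]
  have "set (map (Pair i) (P v)) \<inter> set (tower P (Suc i) k (last (P v))) = {}"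
    using IH by auto
  then have "distinct (tower P i (Suc k) v)"
    using IH \<open>distinct (P v)\<close> by (simp add: distinct_map inj_on_def)
  moreover have "set (tower P (Suc i) k (last (P v))) \<subseteq> {i..<i + Suc k} \<times> V"
    using IH by (auto dest!: subsetD)
  ultimately show ?case
    using \<open>P v \<noteq> []\<close> \<open>set (P v) \<subseteq> V\<close> \<open>hd (P v) = v\<close>
    by (auto simp: hd_map)
qed simp

lemma image_mset_sum: "(\<Sum>v\<in>V. image_mset f (g v)) = image_mset f (\<Sum>v\<in>V. g v)"
  by (induction V rule: infinite_finite_induct) auto

text \<open>The map from \<open>v\<close> to \<open>last (P v)\<close> permutes \<open>V\<close>.
  Summing over all starts therefore uses each rung above layer \<open>i\<close> once, and the upper
  parts are again all towers from layer \<open>Suc i\<close>, each once.\<close>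

lemma sum_tower_edges:
  assumes P: "path_system V E P" and V: "finite V" "\<forall>e\<in>E. card e = 2 \<and> e \<subseteq> V"
  shows "(\<Sum>v\<in>V. path_edges (tower P i k v)) = mset_set (tower_edges V E i k) \<and> finite (tower_edges V E i k)"
proof (induction k arbitrary: i)
  case 0
  then show ?case by (simp add: tower_edges_0)
next
  case (Suc k)
  have fE: "finite E"
    using V by (meson Pow_iff finite_Pow_iff finite_subset subsetI)
  have bij: "bij_betw (\<lambda>v. last (P v)) V V"
    using P by (simp add: path_system_def)
  let ?rung = "\<lambda>v. {(i, v), (Suc i, v)}"
  let ?R = "if k = 0 then {} else ?rung ` V"
  let ?T = "\<lambda>v. tower P (Suc i) k v"
  have "path_edges (tower P i (Suc k) v) = image_mset ((`) (Pair i)) (path_edges (P v)) +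
      ((if k = 0 then {#} else {#?rung (last (P v))#}) + path_edges (?T (last (P v))))"
    if "v \<in> V" for v
  proof -
    have Pv: "P v \<noteq> []" "last (P v) \<in> V"
      using P that bij by (auto simp: path_system_def bij_betw_def)
    then show ?thesis
      using tower_path[OF P Pv(2), of "Suc i" k]
      by (cases "k = 0") (simp_all add: path_edges_append path_edges_map last_map)
  qed
  then have "(\<Sum>v\<in>V. path_edges (tower P i (Suc k) v)) =
      image_mset ((`) (Pair i)) (\<Sum>v\<in>V. path_edges (P v)) +
      ((\<Sum>v\<in>V. if k = 0 then {#} else {#?rung (last (P v))#}) + (\<Sum>v\<in>V. path_edges (?T (last (P v)))))"
    by (simp add: sum.distrib image_mset_sum)
  also have "image_mset ((`) (Pair i)) (\<Sum>v\<in>V. path_edges (P v)) = mset_set ((`) (Pair i) ` E)"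
    using P by (simp add: path_system_def image_mset_mset_set inj_on_def inj_image_eq_iff)
  also have "(\<Sum>v\<in>V. if k = 0 then {#} else {#?rung (last (P v))#}) = mset_set ?R"
  proof (cases "k = 0")
    case False
    have "(\<Sum>v\<in>V. {#?rung (last (P v))#}) = (\<Sum>v\<in>V. {#?rung v#})"
      using sum.reindex_bij_betw[OF bij, of "\<lambda>v. {#?rung v#}"] .
    also have "\<dots> = image_mset ?rung (mset_set V)"
      using V(1) by (induction V rule: finite_induct) auto
    also have "\<dots> = mset_set (?rung ` V)"
      by (intro image_mset_mset_set) (auto simp: inj_on_def doubleton_eq_iff)
    finally show ?thesis using False by simp
  qed simp
  also have "(\<Sum>v\<in>V. path_edges (?T (last (P v)))) = mset_set (tower_edges V E (Suc i) k)"
    using sum.reindex_bij_betw[OF bij, of "\<lambda>v. path_edges (?T v)"] Suc.IH by simp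
  also have "mset_set ((`) (Pair i) ` E) + (mset_set ?R + mset_set (tower_edges V E (Suc i) k)) =
      mset_set ((`) (Pair i) ` E \<union> (?R \<union> tower_edges V E (Suc i) k))"
  proof -
    \<comment> \<open>First coordinates separate the three kinds of edges: all above
      \<open>i\<close>, all equal to \<open>i\<close>, or both values present. Nonemptiness keeps
      the universal statements from holding vacuously.\<close>
    have up: "x \<noteq> {} \<and> (\<forall>z\<in>x. fst z > i)" if "x \<in> tower_edges V E (Suc i) k" for x
      using that V(2) by (fastforce simp: tower_edges_def)
    have low: "x \<noteq> {} \<and> (\<forall>z\<in>x. fst z = i)" if "x \<in> (`) (Pair i) ` E" for x
      using that V(2) by fastforce
    have mid: "(\<exists>z\<in>x. fst z = i) \<and> (\<exists>z\<in>x. fst z > i)" if "x \<in> ?R" for x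
      using that by (auto split: if_splits)
    have "?R \<inter> tower_edges V E (Suc i) k = {}"
      using up mid by fastforce
    moreover have "(`) (Pair i) ` E \<inter> ?R = {}"
      using low mid by fastforce
    moreover have "(`) (Pair i) ` E \<inter> tower_edges V E (Suc i) k = {}"
    proof (rule equals0I)
      fix x assume x: "x \<in> (`) (Pair i) ` E \<inter> tower_edges V E (Suc i) k"
      show False
        using low[OF IntD1[OF x]] up[OF IntD2[OF x]] by force
    qed
    ultimately have disj: "?R \<inter> tower_edges V E (Suc i) k = {}"
      "(`) (Pair i) ` E \<inter> (?R \<union> tower_edges V E (Suc i) k) = {}"
      by blast+
    have fin: "finite ?R" "finite (tower_edges V E (Suc i) k)" "finite ((`) (Pair i) ` E)"
      using V(1) fE Suc.IH by simp_all
    show ?thesis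
      using mset_set_Union[OF fin(1,2) disj(1)] mset_set_Union[OF fin(3) finite_UnI[OF fin(1,2)] disj(2)]
      by metis
  qed
  finally show ?case
    using V(1) fE Suc.IH by (simp add: tower_edges_Suc)
qed

section \<open>The product of a path with \<open>H\<close>\<close>

lemma edges_path_graph: "edges (path_graph m) = {{i, Suc i} | i. Suc i < m}"
proof -
  have "edges (path_graph m) = {{[0..<m] ! i, [0..<m] ! Suc i} | i. Suc i < m}"
    by (simp add: path_graph_def path_of_def)
  also have "\<dots> = {{i, Suc i} | i. Suc i < m}"
    by (intro Collect_cong ex_cong1) auto
  finally show ?thesis .
qed

lemma product_edgeI:
  assumes "(u1, v1) \<in> verts G \<times> verts H" "(u2, v2) \<in> verts G \<times> verts H"
    and "{u1, u2} \<in> edges G \<and> v1 = v2 \<or> {v1, v2} \<in> edges H \<and> u1 = u2"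
  shows "{(u1, v1), (u2, v2)} \<in> edges (cartesian_product G H)"
  using assms unfolding cartesian_product_def graph.sel by blast

lemma edges_prism:
  assumes "simple_graph H"
  shows "edges (cartesian_product (path_graph m) H) = tower_edges (verts H) (edges H) 0 m"
proof
  show "edges (cartesian_product (path_graph m) H) \<subseteq> tower_edges (verts H) (edges H) 0 m"
  proof
    fix x assume "x \<in> edges (cartesian_product (path_graph m) H)"
    then obtain u1 v1 u2 v2 where x: "x = {(u1, v1), (u2, v2)}"
      and V: "(u1, v1) \<in> verts (path_graph m) \<times> verts H" "(u2, v2) \<in> verts (path_graph m) \<times> verts H"
      and A: "{u1, u2} \<in> edges (path_graph m) \<and> v1 = v2 \<or> {v1, v2} \<in> edges H \<and> u1 = u2"
      unfolding cartesian_product_def graph.sel by blast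
    have V': "u1 < m" "v1 \<in> verts H"
      using V by (simp_all add: path_graph_def)
    have "(\<exists>i. {u1, u2} = {i, Suc i} \<and> Suc i < m) \<and> v1 = v2 \<or> {v1, v2} \<in> edges H \<and> u1 = u2"
      using A unfolding edges_path_graph by blast
    then show "x \<in> tower_edges (verts H) (edges H) 0 m"
    proof (elim disjE conjE exE)
      fix i assume "{u1, u2} = {i, Suc i}" "Suc i < m" "v1 = v2"
      then have "x = {(i, v1), (Suc i, v1)}"
        unfolding x doubleton_eq_iff by auto
      then show ?thesis using \<open>Suc i < m\<close> V'(2) tower_edges_rung[of 0 i m] by simp
    next
      assume "{v1, v2} \<in> edges H" "u1 = u2"
      moreover have "x = Pair u1 ` {v1, v2}" using x \<open>u1 = u2\<close> by simp
      ultimately show ?thesis using V'(1) tower_edges_layer[of 0 u1 m "{v1, v2}" "edges H" "verts H"] by simp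
    qed
  qed
  show "tower_edges (verts H) (edges H) 0 m \<subseteq> edges (cartesian_product (path_graph m) H)"
  proof
    fix x assume "x \<in> tower_edges (verts H) (edges H) 0 m"
    then show "x \<in> edges (cartesian_product (path_graph m) H)"
    proof (cases rule: tower_edges_cases)
      case (layer j e)
      then obtain a b where ab: "e = {a, b}" "a \<in> verts H" "b \<in> verts H"
        using assms by (metis card_2_iff insert_subset simple_graph_def)
      then have "x = {(j, a), (j, b)}" using layer by simp
      then show ?thesis
        using product_edgeI[of j a "path_graph m" H j b] ab layer by (simp add: path_graph_def)
    next
      case (rung j v)
      moreover have "{j, Suc j} \<in> edges (path_graph m)"
        using rung unfolding edges_path_graph by auto
      ultimately show ?thesis
        using product_edgeI[of j v "path_graph m" H "Suc j" v] by (simp add: path_graph_def)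
    qed
  qed
qed

text \<open>In an end layer exactly one rung is added to the even degree in
  \<open>H\<close>.\<close>

lemma odd_degree_end_layer:
  assumes H: "even_graph H" and v: "v \<in> verts H" and m: "m \<ge> 2" and i: "i = 0 \<or> i = m - 1"
  shows "odd (degree (cartesian_product (path_graph m) H) (i, v))"
proof -
  \<comment> \<open>The lower layer of that rung; the top layer \<open>m - 1\<close> is reached from
    \<open>m - 2\<close>.\<close>
  let ?j = "if i = 0 then 0 else m - 2"
  let ?r = "{(?j, v), (Suc ?j, v)}"
  have s: "simple_graph H" using H by (simp add: even_graph_def)
  have "finite (edges H)"
    using s by (meson Pow_iff finite_Pow_iff finite_subset subsetI simple_graph_def)
  have "{e \<in> tower_edges (verts H) (edges H) 0 m. (i, v) \<in> e} =
      insert ?r ((`) (Pair i) ` {e \<in> edges H. v \<in> e})" (is "?L = ?R")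
  proof
    show "?L \<subseteq> ?R"
    proof
      fix x assume x: "x \<in> ?L"
      then have "x \<in> tower_edges (verts H) (edges H) 0 m" by simp
      then show "x \<in> ?R"
      proof (cases rule: tower_edges_cases)
        case (layer j e)
        then have "j = i" "v \<in> e" using x by auto
        then show ?thesis using layer by blast
      next
        case (rung j w)
        then have "w = v" "i = j \<or> i = Suc j" using x by auto
        moreover have "j = 0" if "i = 0" using that \<open>i = j \<or> i = Suc j\<close> by auto
        moreover have "j = m - 2" if "i \<noteq> 0"
          using that i m \<open>i = j \<or> i = Suc j\<close> rung(3) by arith
        ultimately have "j = ?j" by simp
        then show ?thesis using rung(1) \<open>w = v\<close> by simp
      qed
    qed
    have "?r \<in> tower_edges (verts H) (edges H) 0 m"
      using tower_edges_rung[of 0 ?j m v] m v by auto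
    moreover have "(i, v) \<in> ?r"
    proof (cases "i = 0")
      case False
      then have "Suc (m - 2) = i" using m i by arith
      then show ?thesis using False by simp
    qed simp
    moreover have "Pair i ` e \<in> ?L" if "e \<in> edges H" "v \<in> e" for e
      using that m i tower_edges_layer[of 0 i m] by auto
    ultimately show "?R \<subseteq> ?L" by blast
  qed
  moreover have "{(j, v), (Suc j, v)} \<notin> (`) (Pair i) ` {e \<in> edges H. v \<in> e}" for j
  proof
    assume "{(j, v), (Suc j, v)} \<in> (`) (Pair i) ` {e \<in> edges H. v \<in> e}"
    then have "\<forall>z\<in>{(j, v), (Suc j, v)}. fst z = i" by auto
    then show False by auto
  qed
  moreover have "card ((`) (Pair i) ` {e \<in> edges H. v \<in> e}) = degree H v"
    unfolding degree_def by (intro card_image) (simp add: inj_on_def inj_image_eq_iff)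
  ultimately have "degree (cartesian_product (path_graph m) H) (i, v) = Suc (degree H v)"
    using \<open>finite (edges H)\<close> by (simp add: degree_def edges_prism[OF s])
  then show ?thesis using H v by (simp add: even_graph_def)
qed

theorem theorem5p3:
  fixes H :: "'a graph" and n m :: nat
  assumes "even_graph H"
    and "order H = n"
    and "m \<ge> 2"
  shows "real (path_number (cartesian_product (path_graph m) H))
           = real (n_odd (cartesian_product (path_graph m) H)) / 2"
proof -
  let ?G = "cartesian_product (path_graph m) H"
  have s: "simple_graph H" using assms(1) by (simp add: even_graph_def)
  then have V: "finite (verts H)" "\<forall>e\<in>edges H. e \<subseteq> verts H \<and> card e = 2"
    by (auto simp: simple_graph_def)
  obtain P where P: "path_system (verts H) (edges H) P"
    using path_system_exists[OF V] assms(1) by (auto simp: even_graph_def degree_def edge_degree_def)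
  have vG: "verts ?G = {0..<m} \<times> verts H"
    by (simp add: cartesian_product_def path_graph_def)
  \<comment> \<open>One tower through all \<open>m\<close> layers for each of the \<open>n\<close>
    vertices.\<close>
  let ?D = "image_mset (tower P 0 m) (mset_set (verts H))"
  have "path_mset ?D (edges ?G)"
    using sum_tower_edges[OF P V(1), of 0 m] V tower_path[OF P, of _ 0 m] assms(3)
    by (simp add: path_mset_def edges_prism[OF s] sum_unfold_sum_mset image_mset.compositionality comp_def)
  moreover have "set p \<subseteq> verts ?G" if "p \<in># ?D" for p
    using that V(1) tower_path[OF P, of _ 0 m] by (auto simp: vG)
  ultimately have upper: "path_number ?G \<le> n"
    using path_number_le[of ?D ?G] assms(2) by (simp add: order_def)
  have "{0, m - 1} \<times> verts H \<subseteq> {v \<in> verts ?G. odd (degree ?G v)}"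
    using odd_degree_end_layer[OF assms(1) _ assms(3)] assms(3) by (auto simp: vG)
  moreover have "finite {v \<in> verts ?G. odd (degree ?G v)}"
    using V(1) by (simp add: vG)
  ultimately have "card ({0, m - 1} \<times> verts H) \<le> n_odd ?G"
    unfolding n_odd_def by (rule card_mono[rotated])
  \<comment> \<open>The two end layers are different because \<open>m\<close> is at least 2.\<close>
  then have "2 * n \<le> n_odd ?G"
    using assms(2,3) by (simp add: card_cartesian_product order_def card_insert_if)
  moreover have "n_odd ?G \<le> 2 * path_number ?G"
  proof -
    have "\<exists>k D. path_decomposition ?G D \<and> card D = k"
      using path_decomposition_exists simple_graph_cartesian_product[OF simple_graph_path_graph s] by blast
    then have "\<exists>D. path_decomposition ?G D \<and> card D = path_number ?G"
      unfolding path_number_def by (rule LeastI_ex)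
    then show ?thesis using n_odd_le by metis
  qed
  \<comment> \<open>The chain \<open>2 * n <= n_odd <= 2 * path_number <= 2 * n\<close> forces
    equality, so degrees in inner layers need not be computed.\<close>
  ultimately have "2 * path_number ?G = n_odd ?G" using upper by linarith
  then show ?thesis by simp
qed

end
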